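(* Let $(\alpha,\beta)\in\mathbb{X}=[0,1]^2\setminus\{(x,y)\mid x+y=1\}$ be a point whose iteration by the negative slope algorithm $T$ does not stop, and let $(\varepsilon_k,n_k,m_k)_{k\ge 1}$ be its digit sequence. Consider the induction (positive induction sequence) $\{\,{}^{t}A^{-1}_{(\varepsilon_{k+1},n_{k+1},m_{k+1})}:\mathbb{Z}^3\to\mathbb{Z}^3\}_{k\ge 0}$, where ${}^{t}A^{-1}$ denotes the transpose of $A^{-1}$. Define $\theta_k:\mathbb{Z}^3\to\mathbb{Z}^3$ by $\theta_0=\mathrm{identity}$ and $\theta_k={}^{t}\Psi_{\Delta_k}^{-1}$ (the inverse of the transpose of $\Psi_{\Delta_k}$) for $k\ge 1$, and put $$P_{\alpha,\beta}=\{\mathbf 0\}\cup\{\mathbf v\in\mathbb{Z}^3\mid (\alpha,\beta,1)\mathbf v>0\}.$$ Then $(\mathbb{Z}^3,P_{\alpha,\beta})$ is the dimension group determined by the induction $\{{}^{t}A^{-1}_{(\varepsilon_{k+1},n_{k+1},m_{k+1})}\}_{k\ge 0}$, with $\{\theta_k\}_{k\ge 0}$ as canonical homomorphisms. That is, there is a group isomorphism from $G=\varinjlim(\mathbb{Z}^3,{}^{t}A^{-1}_{(\varepsilon_{k+1},n_{k+1},m_{k+1})})$ onto $\mathbb{Z}^3$ which, for every $k\ge 0$, carries the canonical homomorphism $\mathbb{Z}^3\to G$ from the $k$-th term to $\theta_k$, and which carries the natural positive cone $G_+$ of $G$ onto $P_{\alpha,\beta}$; in particular $P_{\alpha,\beta}=\bigcup_{k\ge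 0}\theta_k\left((\mathbb{Z}_+)^3\right)$.
   Context: Negative slope algorithm. Let $\mathbb{X}=[0,1]^2\setminus\{(x,y)\mid x+y=1\}$. For $(x,y)\in\mathbb{X}$ set $\varepsilon(x,y)=-1$ if $x+y>1$ and $\varepsilon(x,y)=+1$ if $x+y<1$. With $[\cdot]$ the integer part, set $(n(x,y),m(x,y))=\left(\left[\frac{y}{(x+y)-1}\right],\left[\frac{x}{(x+y)-1}\right]\right)$ if $x+y>1$, and $(n(x,y),m(x,y))=\left(\left[\frac{1-y}{1-(x+y)}\right],\left[\frac{1-x}{1-(x+y)}\right]\right)$ if $x+y<1$. The map $T$ on $\mathbb{X}$ is $T(x,y)=\left(\frac{y}{(x+y)-1}-n(x,y),\ \frac{x}{(x+y)-1}-m(x,y)\right)$ if $x+y>1$, and $T(x,y)=\left(\frac{1-y}{1-(x+y)}-n(x,y),\ \frac{1-x}{1-(x+y)}-m(x,y)\right)$ if $x+y<1$. The digits of $(x,y)$ are $\varepsilon_k=\varepsilon(T^{k-1}(x,y))$, $n_k=n(T^{k-1}(x,y))$, $m_k=m(T^{k-1}(x,y))$ for $k\ge 1$. Write $(x_k,y_k)=T^k(x,y)$ (with $(x_0,y_0)=(x,y)$). The iteration of $(x,y)$ stops if there is $k_0\ge 0$ with $x_{k_0}=0$ or $y_{k_0}=0$ or $x_{k_0}+y_{k_0}=1$. Matrices. For integers $n,m\ge 1$, $$A_{(+1,n,m)}^{-1}=\begin{pmatrix}1&0&n-1\\0&1&m-1\\1&1&n+m-1\end{pmatrix},\qquad A_{(-1,n,m)}^{-1}=\begin{pmatrix}0&1&m\\1&0&n\\1&1&n+m-1\end{pmatrix},$$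 which are invertible over $\mathbb{Z}$. For the digit sequence, $\Psi_{\Delta_k}=A_{(\varepsilon_1,n_1,m_1)}^{-1}\cdots A_{(\varepsilon_k,n_k,m_k)}^{-1}$. Dimension groups. $\mathbb{Z}_+$ is the set of non-negative integers. A positive cone of an abelian group $G$ is a subset $G_+$ with $G_++G_+\subset G_+$, $G_+\cap(-G_+)=\{0\}$, $G_+-G_+=G$, and such that $ng\in G_+$ for a positive integer $n$ implies $g\in G_+$. An induction (positive induction sequence) is a sequence $\{A_{k+1}:\mathbb{Z}^{n_k}\to\mathbb{Z}^{n_{k+1}}\}_{k\ge 0}$ of homomorphisms given by $n_{k+1}\times n_k$ non-negative integer matrices (here $n_k$ denotes the rank of the $k$-th group, not a digit). Its inductive limit group $\varinjlim(\mathbb{Z}^{n_k},A_{k+1})$ is the quotient of $\bigoplus_{k\ge 0}\mathbb{Z}^{n_k}$ by the subgroup generated by the elements $j_l(A_lA_{l-1}\cdots A_{k+1}g)-j_k(g)$, $0\le k<l$, $g\in\mathbb{Z}^{n_k}$, where $j_k:\mathbb{Z}^{n_k}\to\bigoplus_{k\ge 0}\mathbb{Z}^{n_k}$ is the natural embedding. The canonical homomorphism from the $k$-th term is the composition of $j_k$ with the quotient map. The dimension group determined by the induction is the pair $(G,G_+)$ with $G=\varinjlim(\mathbb{Z}^{n_k},A_{k+1})$ and natural positive cone $G_+$ equal to the union over $k\ge 0$ of the images of $(\mathbb{Z}_+)^{n_k}$ under the canonical homomorphisms. *)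

theory Defs
  imports "HOL-Analysis.Analysis" "HOL-Algebra.Product_Groups"
begin

section \<open>The negative slope algorithm\<close>

definition ns_domain :: "(real \<times> real) set" where
  "ns_domain = {(x, y). 0 \<le> x \<and> x \<le> 1 \<and> 0 \<le> y \<and> y \<le> 1 \<and> x + y \<noteq> 1}"

text \<open>
  The functions below are total.  Their values on the line \<open>x + y = 1\<close>, which is not in the domain,
  are irrelevant: the iteration of a point stops when it reaches this line.
\<close>

fun ns_eps :: "real \<times> real \<Rightarrow> int" where
  "ns_eps (x, y) = (if x + y > 1 then -1 else 1)"

fun ns_n :: "real \<times> real \<Rightarrow> int" where
  "ns_n (x, y) = (if x + y > 1 then \<lfloor>y / ((x + y) - 1)\<rfloor> else \<lfloor>(1 - y) / (1 - (x + y))\<rfloor>)"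

fun ns_m :: "real \<times> real \<Rightarrow> int" where
  "ns_m (x, y) = (if x + y > 1 then \<lfloor>x / ((x + y) - 1)\<rfloor> else \<lfloor>(1 - x) / (1 - (x + y))\<rfloor>)"

fun ns_T :: "real \<times> real \<Rightarrow> real \<times> real" where
  "ns_T (x, y) =
    (if x + y > 1
     then (y / ((x + y) - 1) - of_int (ns_n (x, y)), x / ((x + y) - 1) - of_int (ns_m (x, y)))
     else ((1 - y) / (1 - (x + y)) - of_int (ns_n (x, y)),
           (1 - x) / (1 - (x + y)) - of_int (ns_m (x, y))))"

definition ns_stops :: "real \<times> real \<Rightarrow> bool" where
  "ns_stops p \<longleftrightarrow>
    (\<exists>k. fst ((ns_T ^^ k) p) = 0 \<or> snd ((ns_T ^^ k) p) = 0 \<or>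
         fst ((ns_T ^^ k) p) + snd ((ns_T ^^ k) p) = 1)"

text \<open>The digits are indexed by \<open>k \<ge> 1\<close>.\<close>

definition eps_digit :: "real \<times> real \<Rightarrow> nat \<Rightarrow> int" where
  "eps_digit p k = ns_eps ((ns_T ^^ (k - 1)) p)"

definition n_digit :: "real \<times> real \<Rightarrow> nat \<Rightarrow> int" where
  "n_digit p k = ns_n ((ns_T ^^ (k - 1)) p)"

definition m_digit :: "real \<times> real \<Rightarrow> nat \<Rightarrow> int" where
  "m_digit p k = ns_m ((ns_T ^^ (k - 1)) p)"

text \<open>\<open>A_inv \<epsilon> n m\<close> is the matrix written $A_{(\varepsilon,n,m)}^{-1}$, given by its rows.\<close>

definition A_inv :: "int \<Rightarrow> int \<Rightarrow> int \<Rightarrow> int^3^3" where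
  "A_inv \<epsilon> n m =
    (if \<epsilon> = 1
     then vector [vector [1, 0, n - 1],
                  vector [0, 1, m - 1],
                  vector [1, 1, n + m - 1]]
     else vector [vector [0, 1, m],
                  vector [1, 0, n],
                  vector [1, 1, n + m - 1]])"

definition A_inv_digit :: "real \<times> real \<Rightarrow> nat \<Rightarrow> int^3^3" where
  "A_inv_digit p k = A_inv (eps_digit p k) (n_digit p k) (m_digit p k)"

primrec Psi :: "real \<times> real \<Rightarrow> nat \<Rightarrow> int^3^3" where
  "Psi p 0 = mat 1"
| "Psi p (Suc k) = Psi p k ** A_inv_digit p (Suc k)"

definition theta :: "real \<times> real \<Rightarrow> nat \<Rightarrow> int^3 \<Rightarrow> int^3" where
  "theta p k = (if k = 0 then id else (\<lambda>v. matrix_inv (transpose (Psi p k)) *v v))"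

definition P_cone :: "real \<times> real \<Rightarrow> (int^3) set" where
  "P_cone p =
    {0} \<union> {v. (vector [fst p, snd p, 1] :: real^3) \<bullet> (\<chi> i. real_of_int (v $ i)) > 0}"


section \<open>Positive cones and inductive limits of sequences of abelian groups\<close>

text \<open>
  Groups are those of \<open>HOL-Algebra\<close>, hence written multiplicatively: \<open>g [^] n\<close> is the multiple
  \<open>n g\<close>, \<open>set_inv\<close> is the set of negatives and \<open><#>\<close> is the sum of sets.
\<close>

definition positive_cone :: "('a, 'b) monoid_scheme \<Rightarrow> 'a set \<Rightarrow> bool" where
  "positive_cone G P \<longleftrightarrow>
    P \<subseteq> carrier G \<and>
    P <#>\<^bsub>G\<^esub> P \<subseteq> P \<and>
    P \<inter> set_inv\<^bsub>G\<^esub> P = {\<one>\<^bsub>G\<^esub>} \<and>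
    P <#>\<^bsub>G\<^esub> (set_inv\<^bsub>G\<^esub> P) = carrier G \<and>
    (\<forall>g \<in> carrier G. \<forall>n::nat. 0 < n \<and> g [^]\<^bsub>G\<^esub> n \<in> P \<longrightarrow> g \<in> P)"

text \<open>
  A sequence of groups \<open>G k\<close> is connected by homomorphisms \<open>h k\<close> from \<open>G k\<close> to \<open>G (k + 1)\<close>, so that
  \<open>h k\<close> is the map with index \<open>k + 1\<close> in the customary notation $A_{k+1}$.  Then
  \<open>transition h k d\<close> is $A_{k+d} \cdots A_{k+1}$.
\<close>

primrec transition :: "(nat \<Rightarrow> 'a \<Rightarrow> 'a) \<Rightarrow> nat \<Rightarrow> nat \<Rightarrow> 'a \<Rightarrow> 'a" where
  "transition h k 0 = id"
| "transition h k (Suc d) = h (k + d) \<circ> transition h k d"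

definition sum_embedding :: "(nat \<Rightarrow> ('a, 'b) monoid_scheme) \<Rightarrow> nat \<Rightarrow> 'a \<Rightarrow> nat \<Rightarrow> 'a" where
  "sum_embedding G k g = (\<lambda>i. if i = k then g else \<one>\<^bsub>G i\<^esub>)"

definition limit_relations ::
    "(nat \<Rightarrow> ('a, 'b) monoid_scheme) \<Rightarrow> (nat \<Rightarrow> 'a \<Rightarrow> 'a) \<Rightarrow> (nat \<Rightarrow> 'a) set" where
  "limit_relations G h =
    generate (sum_group UNIV G)
      {sum_embedding G l (transition h k (l - k) g)
         \<otimes>\<^bsub>sum_group UNIV G\<^esub> inv\<^bsub>sum_group UNIV G\<^esub> (sum_embedding G k g)
       | k l g. k < l \<and> g \<in> carrier (G k)}"

definition inductive_limit ::
    "(nat \<Rightarrow> ('a, 'b) monoid_scheme) \<Rightarrow> (nat \<Rightarrow> 'a \<Rightarrow> 'a) \<Rightarrow> (nat \<Rightarrow> 'a) set monoid" where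
  "inductive_limit G h = sum_group UNIV G Mod limit_relations G h"

definition canonical_hom ::
    "(nat \<Rightarrow> ('a, 'b) monoid_scheme) \<Rightarrow> (nat \<Rightarrow> 'a \<Rightarrow> 'a) \<Rightarrow> nat \<Rightarrow> 'a \<Rightarrow> (nat \<Rightarrow> 'a) set" where
  "canonical_hom G h k g = limit_relations G h #>\<^bsub>sum_group UNIV G\<^esub> sum_embedding G k g"

definition natural_cone ::
    "(nat \<Rightarrow> ('a, 'b) monoid_scheme) \<Rightarrow> (nat \<Rightarrow> 'a \<Rightarrow> 'a) \<Rightarrow> (nat \<Rightarrow> 'a set) \<Rightarrow> (nat \<Rightarrow> 'a) set set"
  where "natural_cone G h C = (\<Union>k. canonical_hom G h k ` C k)"


section \<open>Dimension groups\<close>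

definition int_vec_group :: "(int^'n) monoid" where
  "int_vec_group = \<lparr>carrier = UNIV, monoid.mult = (+), one = 0\<rparr>"

definition nonneg_int_vec :: "(int^'n) set" where
  "nonneg_int_vec = {v. \<forall>i. 0 \<le> v $ i}"

text \<open>
  Inductions and their limits for groups \<open>int^'n\<close> of constant rank; as above, the matrix \<open>A k\<close> has
  index \<open>k + 1\<close> in customary notation.
\<close>

definition positive_induction :: "(nat \<Rightarrow> int^'n^'n) \<Rightarrow> bool" where
  "positive_induction A \<longleftrightarrow> (\<forall>k i j. 0 \<le> A k $ i $ j)"

definition matrix_limit :: "(nat \<Rightarrow> int^'n^'n) \<Rightarrow> (nat \<Rightarrow> int^'n) set monoid" where
  "matrix_limit A = inductive_limit (\<lambda>_. int_vec_group) (\<lambda>k v. A k *v v)"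

definition matrix_limit_hom :: "(nat \<Rightarrow> int^'n^'n) \<Rightarrow> nat \<Rightarrow> int^'n \<Rightarrow> (nat \<Rightarrow> int^'n) set" where
  "matrix_limit_hom A = canonical_hom (\<lambda>_. int_vec_group) (\<lambda>k v. A k *v v)"

definition matrix_limit_cone :: "(nat \<Rightarrow> int^'n^'n) \<Rightarrow> (nat \<Rightarrow> int^'n) set set" where
  "matrix_limit_cone A = natural_cone (\<lambda>_. int_vec_group) (\<lambda>k v. A k *v v) (\<lambda>_. nonneg_int_vec)"

text \<open>
  \<open>(G, P)\<close> is the dimension group determined by the induction \<open>A\<close>, with canonical homomorphisms
  \<open>\<theta>\<close>: up to an isomorphism these are the inductive limit with its natural cone and its canonical
  homomorphisms.
\<close>

definition is_dimension_group ::
    "('g, 'b) monoid_scheme \<Rightarrow> 'g set \<Rightarrow> (nat \<Rightarrow> int^'n \<Rightarrow> 'g) \<Rightarrow> (nat \<Rightarrow> int^'n^'n) \<Rightarrow> bool" where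
  "is_dimension_group G P \<theta> A \<longleftrightarrow>
    positive_induction A \<and> positive_cone G P \<and>
    (\<exists>\<phi> \<in> iso (matrix_limit A) G.
       (\<forall>k v. \<phi> (matrix_limit_hom A k v) = \<theta> k v) \<and> \<phi> ` matrix_limit_cone A = P)"

definition ns_induction :: "real \<times> real \<Rightarrow> nat \<Rightarrow> int^3^3" where
  "ns_induction p k = transpose (A_inv_digit p (k + 1))"

end

theory Submission
  imports Defs "HOL-Algebra.Free_Abelian_Groups"
begin

text \<open>
  All matrices are invertible over the integers, so the limit is \<open>int^3\<close> and only the cone matters:
  if \<open>(\<alpha>, \<beta>, 1) v > 0\<close>, then some $F_k(v) = {}^t\Psi_{\Delta_k} v$ is non-negative.  Compare $F_k(v)$ with the
  column sums $S_k = F_k(1,1,1)$: the interval spanned by the three quotients of their entries shrinks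
  with \<open>k\<close>, and by at least the factor \<open>4/5\<close> at each \<open>k\<close> for which no entry of $S_k$ exceeds
  twice the third one, since all entries of $F_{k+1}(v)$ then get a sizeable part of the third one of $F_k(v)$.

  There are infinitely many such \<open>k\<close>.  One follows each digit $\varepsilon = -1$.  If all digits are
  eventually $\varepsilon = +1$, then \<open>n \<ge> 2\<close> and \<open>m \<ge> 2\<close> both occur infinitely often, because otherwise
  the largest coordinate of the vector $\Psi_{\Delta_k}^{-1}(\alpha,\beta,1)$ would decrease by a constant forever.
  After \<open>n \<ge> 2\<close> the first entry of $S_k$ is at most the sum of the two others, which persists until
  the next \<open>m \<ge> 2\<close>, and there the required inequality holds.
  Finally $(\alpha,\beta,1) v$ is a positive combination of the entries of $F_k(v)$, so that the
  interval of quotients eventually is positive.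
\<close>

section \<open>Inductive limits of groups\<close>

lemma comm_group_sum_group:
  assumes "\<And>i. i \<in> I \<Longrightarrow> comm_group (G i)"
  shows "comm_group (sum_group I G)"
proof -
  have gr: "\<And>i. i \<in> I \<Longrightarrow> group (G i)"
    using assms by (simp add: comm_group_def)
  show ?thesis
  proof (rule group.group_comm_groupI)
    show "group (sum_group I G)" using gr by simp
    fix x y assume "x \<in> carrier (sum_group I G)" "y \<in> carrier (sum_group I G)"
    then show "x \<otimes>\<^bsub>sum_group I G\<^esub> y = y \<otimes>\<^bsub>sum_group I G\<^esub> x"
      using gr by (auto simp: carrier_sum_group PiE_iff fun_eq_iff restrict_def
          intro!: comm_monoid.m_comm comm_group.axioms(1) assms)
  qed
qed

lemma sum_embedding_closed:
  assumes "\<And>i. group (G i)" and "g \<in> carrier (G k)"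
  shows "sum_embedding G k g \<in> carrier (sum_group UNIV G)"
proof -
  have "{i. sum_embedding G k g i \<noteq> \<one>\<^bsub>G i\<^esub>} \<subseteq> {k}"
    by (auto simp: sum_embedding_def)
  then have "finite {i. sum_embedding G k g i \<noteq> \<one>\<^bsub>G i\<^esub>}"
    using finite_subset by blast
  then show ?thesis
    using assms by (auto simp: carrier_sum_group sum_embedding_def group.is_monoid monoid.one_closed)
qed

lemma sum_embedding_one: "sum_embedding G k \<one>\<^bsub>G k\<^esub> = \<one>\<^bsub>sum_group UNIV G\<^esub>"
  by (auto simp: sum_embedding_def fun_eq_iff)

lemma sum_embedding_mult:
  assumes "\<And>i. group (G i)"
  shows "sum_embedding G k (g \<otimes>\<^bsub>G k\<^esub> g') =
    sum_embedding G k g \<otimes>\<^bsub>sum_group UNIV G\<^esub> sum_embedding G k g'"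
  using assms by (auto simp: sum_embedding_def fun_eq_iff group.is_monoid monoid.l_one monoid.one_closed)

lemma transition_closed:
  assumes "\<And>k. h k \<in> hom (G k) (G (Suc k))" and "g \<in> carrier (G k)"
  shows "transition h k d g \<in> carrier (G (k + d))"
  using assms by (induction d) (auto simp: hom_def)

lemma transition_compatible:
  assumes "\<And>k. h k \<in> hom (G k) (G (Suc k))"
    and "\<And>k g. g \<in> carrier (G k) \<Longrightarrow> \<theta> (Suc k) (h k g) = \<theta> k g"
    and "g \<in> carrier (G k)"
  shows "\<theta> (k + d) (transition h k d g) = \<theta> k g"
  using assms transition_closed[of h G g k] by (induction d) auto

lemma subgroup_limit_relations:
  assumes "\<And>k. group (G k)" and "\<And>k. h k \<in> hom (G k) (G (Suc k))"
  shows "subgroup (limit_relations G h) (sum_group UNIV G)"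
proof -
  interpret S: group "sum_group UNIV G" using assms by simp
  have "sum_embedding G l (transition h k (l - k) g) \<in> carrier (sum_group UNIV G)"
    if "k < l" "g \<in> carrier (G k)" for k l g
    using transition_closed[OF assms(2) that(2), of "l - k"] that(1)
    by (simp add: sum_embedding_closed assms(1))
  then show ?thesis
    unfolding limit_relations_def
    by (intro S.generate_is_subgroup) (auto simp: sum_embedding_closed assms(1) simp del: mult_sum_group inv_sum_group)
qed

lemma limit_relations_step:
  assumes "\<And>k. group (G k)" and "g \<in> carrier (G k)"
  shows "sum_embedding G (Suc k) (h k g)
    \<otimes>\<^bsub>sum_group UNIV G\<^esub> inv\<^bsub>sum_group UNIV G\<^esub> (sum_embedding G k g) \<in> limit_relations G h"
  unfolding limit_relations_def
  using assms by (intro generate.incl CollectI exI[of _ k] exI[of _ "Suc k"] exI[of _ g]) simp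

text \<open>Induction on \<open>N\<close>: what lies below \<open>N\<close> is represented by some
  \<open>y\<close> at stage \<open>N\<close>; together with the entry \<open>x N\<close> it forms
  one element there, which a defining relation pushes on to stage \<open>Suc N\<close>.\<close>

lemma limit_representative:
  assumes G: "\<And>k. comm_group (G k)" and h: "\<And>k. h k \<in> hom (G k) (G (Suc k))"
    and x: "x \<in> carrier (sum_group UNIV G)" and "\<And>i. N \<le> i \<Longrightarrow> x i = \<one>\<^bsub>G i\<^esub>"
  shows "\<exists>y \<in> carrier (G N). x \<otimes>\<^bsub>sum_group UNIV G\<^esub>
    inv\<^bsub>sum_group UNIV G\<^esub> (sum_embedding G N y) \<in> limit_relations G h"
  using x assms(4)
proof (induction N arbitrary: x)
  case 0
  interpret S: comm_group "sum_group UNIV G" using G by (rule comm_group_sum_group)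
  have gr: "\<And>k. group (G k)" using G by (simp add: comm_group_def)
  interpret R: subgroup "limit_relations G h" "sum_group UNIV G"
    using gr h by (rule subgroup_limit_relations)
  have "x = \<one>\<^bsub>sum_group UNIV G\<^esub>"
    using 0 by (simp add: fun_eq_iff)
  then show ?case
    using sum_embedding_one[of G 0] R.one_closed gr 
    by (intro bexI[of _ "\<one>\<^bsub>G 0\<^esub>"]) (simp_all add: group.is_monoid monoid.one_closed del: one_sum_group mult_sum_group)
next
  case (Suc N)
  let ?S = "sum_group UNIV G"
  interpret S: comm_group ?S using G by (rule comm_group_sum_group)
  have gr: "\<And>k. group (G k)" using G by (simp add: comm_group_def)
  interpret R: subgroup "limit_relations G h" ?S
    using gr h by (rule subgroup_limit_relations)
  note emb = sum_embedding_closed[where G = G, OF gr]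
  define x' where "x' = x(N := \<one>\<^bsub>G N\<^esub>)"
  have xN: "x N \<in> carrier (G N)"
    using Suc.prems(1) gr by (auto simp: carrier_sum_group PiE_iff)
  have x': "x' \<in> carrier ?S"
  proof -
    have "finite {i. x' i \<noteq> \<one>\<^bsub>G i\<^esub>}"
    proof (rule finite_subset)
      show "{i. x' i \<noteq> \<one>\<^bsub>G i\<^esub>} \<subseteq> {..<N}"
        using Suc.prems(2) by (auto simp: x'_def not_less_eq_eq intro: ccontr)
    qed simp
    then show ?thesis
      using Suc.prems(1) gr by (auto simp: carrier_sum_group x'_def group.is_monoid monoid.one_closed)
  qed
  have "x' i = \<one>\<^bsub>G i\<^esub>" if "N \<le> i" for i
    using Suc.prems(2)[of i] that by (cases "i = N") (auto simp: x'_def)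
  with Suc.IH[OF x'] obtain y where y: "y \<in> carrier (G N)"
    and yR: "x' \<otimes>\<^bsub>?S\<^esub> inv\<^bsub>?S\<^esub> sum_embedding G N y \<in> limit_relations G h"
    by blast
  have x_eq: "x = x' \<otimes>\<^bsub>?S\<^esub> sum_embedding G N (x N)"
    using Suc.prems(1) gr xN
    by (auto simp: x'_def sum_embedding_def fun_eq_iff carrier_sum_group PiE_iff
        group.is_monoid monoid.l_one monoid.r_one)
  define z where "z = y \<otimes>\<^bsub>G N\<^esub> x N"
  have z: "z \<in> carrier (G N)"
    unfolding z_def using y xN gr by (simp add: group.is_monoid monoid.m_closed)
  have hz: "h N z \<in> carrier (G (Suc N))"
    using h z by (auto simp: hom_def)
  let ?a = "sum_embedding G N y" and ?b = "sum_embedding G N (x N)"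
    and ?c = "sum_embedding G (Suc N) (h N z)" and ?d = "sum_embedding G N z"
  have cl: "?a \<in> carrier ?S" "?b \<in> carrier ?S" "?c \<in> carrier ?S" "?d \<in> carrier ?S"
    using emb y xN hz z by auto
  have d: "?d = ?a \<otimes>\<^bsub>?S\<^esub> ?b"
    unfolding z_def by (rule sum_embedding_mult[OF gr])
  \<comment> \<open>The relation between \<open>z\<close> and \<open>h N z\<close>, inverted:
    multiplying by it cancels stage \<open>N\<close> and leaves stage \<open>Suc N\<close>.\<close>
  have "inv\<^bsub>?S\<^esub> (?c \<otimes>\<^bsub>?S\<^esub> inv\<^bsub>?S\<^esub> ?d) \<in> limit_relations G h"
    using limit_relations_step[of G z N h, OF gr z] by (rule R.m_inv_closed)
  with yR have "(x' \<otimes>\<^bsub>?S\<^esub> inv\<^bsub>?S\<^esub> ?a) \<otimes>\<^bsub>?S\<^esub> inv\<^bsub>?S\<^esub> (?c \<otimes>\<^bsub>?S\<^esub> inv\<^bsub>?S\<^esub> ?d) \<in> limit_relations G h"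
    by (rule R.m_closed)
  also have "(x' \<otimes>\<^bsub>?S\<^esub> inv\<^bsub>?S\<^esub> ?a) \<otimes>\<^bsub>?S\<^esub> inv\<^bsub>?S\<^esub> (?c \<otimes>\<^bsub>?S\<^esub> inv\<^bsub>?S\<^esub> ?d) = x \<otimes>\<^bsub>?S\<^esub> inv\<^bsub>?S\<^esub> ?c"
  proof -
    have "inv\<^bsub>?S\<^esub> (?c \<otimes>\<^bsub>?S\<^esub> inv\<^bsub>?S\<^esub> ?d) = ?a \<otimes>\<^bsub>?S\<^esub> (?b \<otimes>\<^bsub>?S\<^esub> inv\<^bsub>?S\<^esub> ?c)"
      using cl by (simp add: S.inv_mult d S.m_ac del: mult_sum_group inv_sum_group)
    then have "(x' \<otimes>\<^bsub>?S\<^esub> inv\<^bsub>?S\<^esub> ?a) \<otimes>\<^bsub>?S\<^esub> inv\<^bsub>?S\<^esub> (?c \<otimes>\<^bsub>?S\<^esub> inv\<^bsub>?S\<^esub> ?d)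
        = x' \<otimes>\<^bsub>?S\<^esub> (inv\<^bsub>?S\<^esub> ?a \<otimes>\<^bsub>?S\<^esub> (?a \<otimes>\<^bsub>?S\<^esub> (?b \<otimes>\<^bsub>?S\<^esub> inv\<^bsub>?S\<^esub> ?c)))"
      using cl x' by (simp add: S.m_assoc del: mult_sum_group inv_sum_group)
    also have "\<dots> = x \<otimes>\<^bsub>?S\<^esub> inv\<^bsub>?S\<^esub> ?c"
      using cl x' x_eq by (simp add: S.m_assoc [symmetric] del: mult_sum_group inv_sum_group one_sum_group)
    finally show ?thesis .
  qed
  finally show ?case
    using hz by blast
qed

text \<open>First isomorphism theorem for the map that the \<open>\<theta> k\<close> induce on the
  direct sum. Compatibility puts the relations into its kernel; injectivity of every
  \<open>\<theta> k\<close> gives the converse inclusion.\<close>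

lemma inductive_limit_iso:
  fixes G :: "nat \<Rightarrow> ('a, 'b) monoid_scheme" and H :: "('c, 'd) monoid_scheme"
  assumes G: "\<And>k. comm_group (G k)" and H: "comm_group H"
    and h: "\<And>k. h k \<in> hom (G k) (G (Suc k))" and \<theta>: "\<And>k. \<theta> k \<in> hom (G k) H"
    and comp: "\<And>k g. g \<in> carrier (G k) \<Longrightarrow> \<theta> (Suc k) (h k g) = \<theta> k g"
    and inj: "\<And>k. inj_on (\<theta> k) (carrier (G k))"
    and surj: "carrier H \<subseteq> (\<Union>k. \<theta> k ` carrier (G k))"
  obtains \<phi> where "\<phi> \<in> iso (inductive_limit G h) H"
    and "\<And>k g. g \<in> carrier (G k) \<Longrightarrow> \<phi> (canonical_hom G h k g) = \<theta> k g"
proof -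
  let ?S = "sum_group UNIV G" and ?R = "limit_relations G h"
  \<comment> \<open>\<open>gfinprod\<close> multiplies over the indices with nontrivial factor,
    which are finitely many for an element of the direct sum.\<close>
  define \<Phi> where "\<Phi> = (\<lambda>x. gfinprod H (\<lambda>i. \<theta> i (x i)) UNIV)"
  have gr: "\<And>k. group (G k)" using G by (simp add: comm_group_def)
  interpret S: comm_group ?S using G by (rule comm_group_sum_group)
  interpret H: comm_group H by (rule H)
  interpret R: subgroup ?R ?S using gr h by (rule subgroup_limit_relations)
  have "\<Phi> \<in> hom ?S H"
    unfolding \<Phi>_def by (rule H.hom_group_sum) (auto simp: \<theta> gr)
  then interpret \<Phi>: group_hom ?S H \<Phi> by unfold_locales
  note emb = sum_embedding_closed[where G = G, OF gr]
  have one: "\<theta> k \<one>\<^bsub>G k\<^esub> = \<one>\<^bsub>H\<^esub>" for k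
    using \<theta> gr H.is_group by (rule hom_one)
  have \<Phi>_emb: "\<Phi> (sum_embedding G k g) = \<theta> k g" if "g \<in> carrier (G k)" for k g
  proof -
    have cl: "\<theta> k g \<in> carrier H" using \<theta> that by (auto simp: hom_def)
    have "\<Phi> (sum_embedding G k g) = gfinprod H (\<lambda>i. \<theta> i (sum_embedding G k g i)) {k}"
      unfolding \<Phi>_def
      by (rule H.gfinprod_mono_neutral_cong_right) (use one cl in \<open>auto simp: sum_embedding_def\<close>)
    also have "\<dots> = \<theta> k g"
      using cl by (simp add: sum_embedding_def)
    finally show ?thesis .
  qed
  have ker: "kernel ?S H \<Phi> = ?R"
  proof
    show "?R \<subseteq> kernel ?S H \<Phi>"
      unfolding limit_relations_def
    proof (rule S.generate_subgroup_incl[OF _ \<Phi>.subgroup_kernel], clarify)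
      fix k l :: nat and g assume kl: "k < l" and g: "g \<in> carrier (G k)"
      let ?t = "transition h k (l - k) g"
      have t: "?t \<in> carrier (G l)"
        using transition_closed[of h G g k "l - k", OF h g] kl by simp
      have "\<theta> l ?t = \<theta> k g"
        using transition_compatible[of h G \<theta> g k "l - k", OF h comp g] kl by simp
      moreover have "\<theta> k g \<in> carrier H" using \<theta> g by (auto simp: hom_def)
      ultimately show "sum_embedding G l ?t \<otimes>\<^bsub>?S\<^esub> inv\<^bsub>?S\<^esub> sum_embedding G k g \<in> kernel ?S H \<Phi>"
        using t g emb by (simp add: kernel_def \<Phi>_emb del: mult_sum_group inv_sum_group)
    qed
    show "kernel ?S H \<Phi> \<subseteq> ?R"
    proof
      fix x assume "x \<in> kernel ?S H \<Phi>"
      then have x: "x \<in> carrier ?S" and \<Phi>x: "\<Phi> x = \<one>\<^bsub>H\<^esub>" by (auto simp: kernel_def)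
      then have "finite {i. x i \<noteq> \<one>\<^bsub>G i\<^esub>}" using gr by (auto simp: carrier_sum_group)
      then obtain N where "\<And>i. x i \<noteq> \<one>\<^bsub>G i\<^esub> \<Longrightarrow> i < N"
        using finite_nat_set_iff_bounded by auto
      then have "\<And>i. N \<le> i \<Longrightarrow> x i = \<one>\<^bsub>G i\<^esub>" using leD by blast
      \<comment> \<open>Modulo the relations \<open>x\<close> sits at the single stage
        \<open>N\<close>, where injectivity of \<open>\<theta> N\<close> applies.\<close>
      then obtain y where y: "y \<in> carrier (G N)"
        and yR: "x \<otimes>\<^bsub>?S\<^esub> inv\<^bsub>?S\<^esub> sum_embedding G N y \<in> ?R"
        using limit_representative[of G h x N, OF G h x] by blast
      then have "x \<otimes>\<^bsub>?S\<^esub> inv\<^bsub>?S\<^esub> sum_embedding G N y \<in> kernel ?S H \<Phi>"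
        using \<open>?R \<subseteq> kernel ?S H \<Phi>\<close> by blast
      moreover have "\<theta> N y \<in> carrier H" using \<theta> y by (auto simp: hom_def)
      ultimately have "\<theta> N y = \<theta> N \<one>\<^bsub>G N\<^esub>"
        using x y emb \<Phi>x by (simp add: kernel_def \<Phi>_emb one del: mult_sum_group inv_sum_group)
      then have "y = \<one>\<^bsub>G N\<^esub>"
        using inj y gr by (meson group.is_monoid inj_onD monoid.one_closed)
      then show "x \<in> ?R"
        using yR x by (simp add: sum_embedding_one del: mult_sum_group inv_sum_group one_sum_group)
    qed
  qed
  \<comment> \<open>\<open>\<Phi>\<close> is constant on each coset of its kernel, so the image is a
    singleton.\<close>
  define \<phi> where "\<phi> = (\<lambda>X. the_elem (\<Phi> ` X))"
  have "\<Phi> ` carrier ?S = carrier H"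
  proof
    show "carrier H \<subseteq> \<Phi> ` carrier ?S"
    proof
      fix w assume "w \<in> carrier H"
      then have "w \<in> (\<Union>k. \<theta> k ` carrier (G k))" by (rule subsetD[OF surj])
      then obtain k where "w \<in> \<theta> k ` carrier (G k)" by auto
      then obtain g where "g \<in> carrier (G k)" "w = \<Phi> (sum_embedding G k g)"
        using \<Phi>_emb by auto
      then show "w \<in> \<Phi> ` carrier ?S" using emb by auto
    qed
  qed auto
  then have iso: "\<phi> \<in> iso (inductive_limit G h) H"
    unfolding \<phi>_def inductive_limit_def ker[symmetric] by (rule \<Phi>.FactGroup_iso_set)
  have "\<phi> (canonical_hom G h k g) = \<theta> k g" if g: "g \<in> carrier (G k)" for k g
  proof -
    have "\<Phi> w = \<theta> k g" if w: "w \<in> canonical_hom G h k g" for w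
    proof -
      obtain r where r: "r \<in> ?R" "w = r \<otimes>\<^bsub>?S\<^esub> sum_embedding G k g"
        using w unfolding canonical_hom_def r_coset_def by blast
      moreover have "r \<in> carrier ?S" "\<Phi> r = \<one>\<^bsub>H\<^esub>"
        using r(1) unfolding ker[symmetric] by (auto simp: kernel_def)
      moreover have "\<theta> k g \<in> carrier H" using \<theta> g by (auto simp: hom_def)
      ultimately show ?thesis
        using emb[OF g] by (simp add: \<Phi>_emb[OF g] del: mult_sum_group)
    qed
    moreover have "sum_embedding G k g \<in> canonical_hom G h k g"
      unfolding canonical_hom_def using emb[OF g] R.subgroup_axioms by (rule S.rcos_self)
    ultimately have "\<Phi> ` canonical_hom G h k g = {\<theta> k g}" by (auto simp: image_iff)
    then show ?thesis by (simp add: \<phi>_def)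
  qed
  with iso show thesis by (rule that)
qed

section \<open>The negative slope algorithm\<close>

declare transpose_matrix_vector [simp del]

section \<open>The integer matrices, their products and inverses\<close>

lemma transpose_mult_vector_nth:
  fixes f :: "int^3"
  shows "(transpose A *v f) $ i = A $ 1 $ i * f $ 1 + A $ 2 $ i * f $ 2 + A $ 3 $ i * f $ 3"
  by (simp add: matrix_vector_mult_def transpose_def sum_3)

text \<open>The last bound, checked column by column, feeds \<open>row_contraction\<close>. Equality
  occurs for \<open>\<epsilon> \<noteq> 1\<close>, \<open>n = m = 1\<close> and
  \<open>i = 3\<close>.\<close>

lemma A_inv_entries:
  assumes "1 \<le> n" "1 \<le> m"
  shows "0 \<le> A_inv \<epsilon> n m $ 1 $ i" "0 \<le> A_inv \<epsilon> n m $ 2 $ i" "0 < A_inv \<epsilon> n m $ 3 $ i"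
    "A_inv \<epsilon> n m $ 1 $ i + A_inv \<epsilon> n m $ 2 $ i \<le> 2 * A_inv \<epsilon> n m $ 3 $ i"
  using assms exhaust_3[of i] by (auto simp: A_inv_def)

lemma invertible_A_inv: "invertible (A_inv \<epsilon> n m)"
proof (cases "\<epsilon> = 1")
  case True
  \<comment> \<open>\<open>?B\<close> is the adjugate here and in the other case; the determinant is
    1 both times.\<close>
  let ?B = "vector [vector [n, n - 1, 1 - n], vector [m - 1, m, 1 - m], vector [- 1, - 1, 1]] :: int^3^3"
  have "A_inv \<epsilon> n m ** ?B = mat 1 \<and> ?B ** A_inv \<epsilon> n m = mat 1"
    using True by (simp add: A_inv_def matrix_matrix_mult_def mat_def vec_eq_iff forall_3 sum_3 algebra_simps)
  then show ?thesis unfolding invertible_def by blast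
next
  case False
  let ?B = "vector [vector [- n, 1 - n, n], vector [1 - m, - m, m], vector [1, 1, - 1]] :: int^3^3"
  have "A_inv \<epsilon> n m ** ?B = mat 1 \<and> ?B ** A_inv \<epsilon> n m = mat 1"
    using False by (simp add: A_inv_def matrix_matrix_mult_def mat_def vec_eq_iff forall_3 sum_3 algebra_simps)
  then show ?thesis unfolding invertible_def by blast
qed

lemma invertible_transpose_Psi: "invertible (transpose (Psi p k))"
proof -
  have "invertible (Psi p k)"
  proof (induction k)
    case 0
    show ?case by (auto simp: invertible_def intro: exI[of _ "mat 1"])
  next
    case (Suc k)
    obtain B C where B: "Psi p k ** B = mat 1" "B ** Psi p k = mat 1"
      and C: "A_inv_digit p (Suc k) ** C = mat 1" "C ** A_inv_digit p (Suc k) = mat 1"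
      using Suc invertible_A_inv unfolding invertible_def A_inv_digit_def by metis
    have "Psi p (Suc k) ** (C ** B) = Psi p k ** (A_inv_digit p (Suc k) ** C) ** B"
      "(C ** B) ** Psi p (Suc k) = C ** (B ** Psi p k) ** A_inv_digit p (Suc k)"
      by (simp_all add: matrix_mul_assoc)
    then show ?case
      unfolding invertible_def using B C by auto
  qed
  then show ?thesis
    unfolding invertible_def by (metis matrix_transpose_mul transpose_mat)
qed

lemma theta_eq: "theta p k = (\<lambda>v. matrix_inv (transpose (Psi p k)) *v v)"
proof (cases k)
  case 0
  have "matrix_inv (mat 1 :: int^3^3) = mat 1"
    unfolding matrix_inv_def by (rule some_equality) auto
  then show ?thesis using 0 by (simp add: theta_def fun_eq_iff transpose_mat)
qed (simp add: theta_def)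

lemma matrix_inv_transpose_Psi:
  "transpose (Psi p k) ** matrix_inv (transpose (Psi p k)) = mat 1"
  "matrix_inv (transpose (Psi p k)) ** transpose (Psi p k) = mat 1"
  using invertible_transpose_Psi[of p k] someI_ex[of "\<lambda>B. transpose (Psi p k) ** B = mat 1 \<and> B ** transpose (Psi p k) = mat 1"]
  unfolding invertible_def matrix_inv_def by blast+

lemma theta_left_inverse [simp]: "theta p k (transpose (Psi p k) *v v) = v"
  by (simp add: theta_eq matrix_vector_mul_assoc matrix_inv_transpose_Psi)

lemma theta_right_inverse [simp]: "transpose (Psi p k) *v theta p k v = v"
  by (simp add: theta_eq matrix_vector_mul_assoc matrix_inv_transpose_Psi)

lemma transpose_Psi_Suc:
  "transpose (Psi p (Suc k)) *v v = ns_induction p k *v (transpose (Psi p k) *v v)"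
  by (simp add: ns_induction_def matrix_transpose_mul matrix_vector_mul_assoc)

text \<open>Compatibility of the canonical homomorphisms with the induction, obtained by undoing one
  more factor of the matrix product.\<close>

lemma theta_ns_induction: "theta p (Suc k) (ns_induction p k *v g) = theta p k g"
  using theta_left_inverse[of p "Suc k" "theta p k g"] by (simp add: transpose_Psi_Suc del: theta_left_inverse Psi.simps)

text \<open>\<open>U\<close>, \<open>V\<close>, \<open>W\<close> stand for the entries of
  \<open>S k\<close>, the \<open>f\<close>s for those of the transported vector, the
  \<open>b\<close>s for a matrix column. As \<open>U\<close> and \<open>V\<close> are at most
  \<open>2 * W\<close> and \<open>b1 + b2 \<le> 2 * b3\<close>, the whole sum is at most
  \<open>(2 * 2 + 1) * b3 * W\<close>; so the surplus \<open>r - lo\<close> of the third entry lifts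
  the total quotient by at least a fifth.\<close>

lemma row_contraction:
  fixes U V W :: real
  assumes b: "0 \<le> b1" "0 \<le> b2" "b1 + b2 \<le> 2 * b3"
    and W: "0 \<le> W" "U \<le> 2 * W" "V \<le> 2 * W"
    and f: "lo * U \<le> f1" "lo * V \<le> f2" "f3 = r * W" "lo \<le> r"
  shows "(lo + (r - lo) / 5) * (b1 * U + b2 * V + b3 * W) \<le> b1 * f1 + b2 * f2 + b3 * f3"
proof -
  have "b1 * U + b2 * V + b3 * W \<le> b1 * (2 * W) + b2 * (2 * W) + b3 * W"
    using b W by (intro add_mono mult_left_mono) auto
  also have "\<dots> \<le> 5 * b3 * W"
    using mult_right_mono[OF b(3) W(1)] by (simp add: algebra_simps)
  finally have bound: "b1 * U + b2 * V + b3 * W \<le> 5 * b3 * W" .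
  define d where "d = (r - lo) / 5"
  have "0 \<le> d" using f(4) by (simp add: d_def)
  have "r = lo + 5 * d" by (simp add: d_def field_simps)
  then have f3: "f3 = (lo + 5 * d) * W" using f(3) by simp
  have "d * (b1 * U + b2 * V + b3 * W) \<le> d * (5 * b3 * W)"
    using bound \<open>0 \<le> d\<close> by (rule mult_left_mono)
  moreover have "b1 * (lo * U) + b2 * (lo * V) \<le> b1 * f1 + b2 * f2"
    using b f by (intro add_mono mult_left_mono) auto
  ultimately show ?thesis
    unfolding d_def[symmetric] f3 by (simp add: algebra_simps)
qed

section \<open>Orbits that do not stop and the invariant linear form\<close>

locale ns_orbit =
  fixes p :: "real \<times> real"
  assumes domain: "p \<in> ns_domain" and not_stops: "\<not> ns_stops p"
begin

definition x :: "nat \<Rightarrow> real" where "x k = fst ((ns_T ^^ k) p)"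
definition y :: "nat \<Rightarrow> real" where "y k = snd ((ns_T ^^ k) p)"
definition n :: "nat \<Rightarrow> int" where "n k = n_digit p (Suc k)"
definition m :: "nat \<Rightarrow> int" where "m k = m_digit p (Suc k)"

text \<open>
  With these weights, \<open>A_inv_digit p (k + 1)\<close> maps \<open>c (k + 1) (x (k + 1), y (k + 1), 1)\<close>
  to \<open>c k (x k, y k, 1)\<close>.
\<close>

definition c :: "nat \<Rightarrow> real" where "c k = (\<Prod>i<k. \<bar>1 - x i - y i\<bar>)"

definition pairing :: "nat \<Rightarrow> int^3 \<Rightarrow> real" where
  "pairing k f = x k * f $ 1 + y k * f $ 2 + f $ 3"

lemma orbit: "(ns_T ^^ k) p = (x k, y k)"
  by (simp add: x_def y_def)

lemma x_Suc: "x (Suc k) = fst (ns_T (x k, y k))" and y_Suc: "y (Suc k) = snd (ns_T (x k, y k))"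
  by (simp_all add: x_def y_def)

lemma orbit_not_stops: "x k \<noteq> 0" "y k \<noteq> 0" "x k + y k \<noteq> 1"
  using not_stops by (auto simp: ns_stops_def x_def y_def)

lemma n_eq: "n k = ns_n (x k, y k)" and m_eq: "m k = ns_m (x k, y k)"
  by (simp_all add: n_def m_def n_digit_def m_digit_def orbit)

lemma ns_T_range: "0 \<le> fst (ns_T q)" "fst (ns_T q) < 1" "0 \<le> snd (ns_T q)" "snd (ns_T q) < 1"
  by (cases q; simp; linarith)+

lemma x_y_bounds: "0 < x k" "x k < 1" "0 < y k" "y k < 1"
proof -
  have le: "0 \<le> x k \<and> x k \<le> 1 \<and> 0 \<le> y k \<and> y k \<le> 1"
  proof (cases k)
    case 0
    then show ?thesis using domain by (simp add: ns_domain_def x_def y_def split_beta)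
  next
    case (Suc j)
    then show ?thesis
      using ns_T_range[of "(x j, y j)"] by (simp add: x_Suc y_Suc less_imp_le del: ns_T.simps)
  qed
  show "0 < x k" "0 < y k" using le orbit_not_stops[of k] by auto
  \<comment> \<open>At \<open>x k = 1\<close> the quotient defining \<open>x (Suc k)\<close> is
    \<open>y k / y k = 1\<close>, so its fractional part is 0 and the iteration would stop; likewise
    for \<open>y k = 1\<close>.\<close>
  have "x k \<noteq> 1"
    using \<open>0 < y k\<close> orbit_not_stops(1)[of "Suc k"] by (auto simp: x_Suc)
  then show "x k < 1" using le by auto
  have "y k \<noteq> 1"
    using \<open>0 < x k\<close> orbit_not_stops(2)[of "Suc k"] by (auto simp: y_Suc)
  then show "y k < 1" using le by auto
qed

text \<open>Numerator minus denominator of the quotients is \<open>1 - x k\<close> and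
  \<open>1 - y k\<close> when the sum exceeds 1, and \<open>x k\<close> and \<open>y k\<close>
  otherwise.\<close>

lemma n_ge: "1 \<le> n k" and m_ge: "1 \<le> m k"
  using x_y_bounds[of k] orbit_not_stops(3)[of k]
  by (auto simp: n_eq m_eq le_floor_iff le_divide_eq)

lemma A_inv_digit_eq: "A_inv_digit p (Suc k) = A_inv (if x k + y k > 1 then - 1 else 1) (n k) (m k)"
  by (simp add: A_inv_digit_def eps_digit_def n_def m_def orbit)

lemma ns_induction_nth:
  "(ns_induction p k *v f) $ 1 = (if x k + y k > 1 then f $ 2 + f $ 3 else f $ 1 + f $ 3)"
  "(ns_induction p k *v f) $ 2 = (if x k + y k > 1 then f $ 1 + f $ 3 else f $ 2 + f $ 3)"
  "(ns_induction p k *v f) $ 3 = (if x k + y k > 1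
     then m k * f $ 1 + n k * f $ 2 + (n k + m k - 1) * f $ 3
     else (n k - 1) * f $ 1 + (m k - 1) * f $ 2 + (n k + m k - 1) * f $ 3)"
  by (simp_all add: ns_induction_def A_inv_digit_eq transpose_mult_vector_nth A_inv_def)

text \<open>\<open>ns_T\<close> solved for the old point, that is, the rows of \<open>A_inv\<close>
  applied to the new one.\<close>

lemma step_lower:
  assumes "x k + y k < 1"
  shows "x k = (1 - x k - y k) * (x (Suc k) + n k - 1)" "y k = (1 - x k - y k) * (y (Suc k) + m k - 1)"
    "1 = (1 - x k - y k) * (x (Suc k) + y (Suc k) + n k + m k - 1)"
proof -
  define t where "t = 1 - x k - y k"
  show x: "x k = (1 - x k - y k) * (x (Suc k) + n k - 1)" and y: "y k = (1 - x k - y k) * (y (Suc k) + m k - 1)"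
    using assms by (simp_all add: x_Suc y_Suc n_eq m_eq) (simp_all add: field_simps)
  have "t * (x (Suc k) + y (Suc k) + n k + m k - 1)
      = t * (x (Suc k) + n k - 1) + t * (y (Suc k) + m k - 1) + t"
    by (simp add: algebra_simps)
  also have "\<dots> = 1"
    using x y by (simp add: t_def)
  finally show "1 = (1 - x k - y k) * (x (Suc k) + y (Suc k) + n k + m k - 1)"
    by (simp add: t_def)
qed

lemma step_upper:
  assumes "x k + y k > 1"
  shows "x k = (x k + y k - 1) * (y (Suc k) + m k)" "y k = (x k + y k - 1) * (x (Suc k) + n k)"
    "1 = (x k + y k - 1) * (x (Suc k) + y (Suc k) + n k + m k - 1)"
proof -
  define t where "t = x k + y k - 1"
  show x: "x k = (x k + y k - 1) * (y (Suc k) + m k)" and y: "y k = (x k + y k - 1) * (x (Suc k) + n k)"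
    using assms by (simp_all add: x_Suc y_Suc n_eq m_eq)
  have "t * (x (Suc k) + y (Suc k) + n k + m k - 1)
      = t * (y (Suc k) + m k) + t * (x (Suc k) + n k) - t"
    by (simp add: algebra_simps)
  also have "\<dots> = 1"
    using x y by (simp add: t_def)
  finally show "1 = (x k + y k - 1) * (x (Suc k) + y (Suc k) + n k + m k - 1)"
    by (simp add: t_def)
qed

text \<open>Transposition moves the matrix from \<open>f\<close> to the row
  \<open>(x (Suc k), y (Suc k), 1)\<close>, where the step identities give back the old row up to
  the scale factor.\<close>

lemma pairing_Suc: "pairing k f = \<bar>1 - x k - y k\<bar> * pairing (Suc k) (ns_induction p k *v f)"
proof (cases "x k + y k > 1")
  case True
  define t where "t = x k + y k - 1"
  have "t * pairing (Suc k) (ns_induction p k *v f) =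
      (t * (y (Suc k) + m k)) * f $ 1 + (t * (x (Suc k) + n k)) * f $ 2
      + (t * (x (Suc k) + y (Suc k) + n k + m k - 1)) * f $ 3"
    using True by (simp add: pairing_def ns_induction_nth algebra_simps)
  also have "\<dots> = pairing k f"
    using step_upper[OF True] by (simp add: pairing_def t_def)
  finally have "t * pairing (Suc k) (ns_induction p k *v f) = pairing k f" .
  moreover have "\<bar>1 - x k - y k\<bar> = t" using True by (simp add: t_def)
  ultimately show ?thesis by simp
next
  case False
  define t where "t = 1 - x k - y k"
  have lt: "x k + y k < 1" using False orbit_not_stops(3)[of k] by simp
  have "t * pairing (Suc k) (ns_induction p k *v f) =
      (t * (x (Suc k) + n k - 1)) * f $ 1 + (t * (y (Suc k) + m k - 1)) * f $ 2
      + (t * (x (Suc k) + y (Suc k) + n k + m k - 1)) * f $ 3"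
    using False by (simp add: pairing_def ns_induction_nth algebra_simps)
  also have "\<dots> = pairing k f"
    using step_lower[OF lt] by (simp add: pairing_def t_def)
  finally have "t * pairing (Suc k) (ns_induction p k *v f) = pairing k f" .
  moreover have "\<bar>1 - x k - y k\<bar> = t" using lt by (simp add: t_def)
  ultimately show ?thesis by simp
qed

lemma c_pos: "0 < c k"
  unfolding c_def by (rule prod_pos) (use orbit_not_stops(3) in \<open>auto simp: algebra_simps\<close>)

lemma pairing_eq: "pairing 0 v = c k * pairing k (transpose (Psi p k) *v v)"
proof (induction k)
  case 0
  show ?case by (simp add: c_def transpose_mat)
next
  case (Suc k)
  then show ?case
    using pairing_Suc[of k "transpose (Psi p k) *v v"]
    by (simp add: transpose_Psi_Suc c_def del: Psi.simps)
qed

lemma pairing_pos: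
  assumes "f \<in> nonneg_int_vec" "f \<noteq> 0"
  shows "0 < pairing k f"
proof -
  have f: "0 \<le> f $ 1" "0 \<le> f $ 2" "0 \<le> f $ 3" using assms(1) by (auto simp: nonneg_int_vec_def)
  have "f $ 1 > 0 \<or> f $ 2 > 0 \<or> f $ 3 > 0"
    using f assms(2) by (auto simp: vec_eq_iff forall_3)
  moreover have "0 \<le> x k * f $ 1" "0 \<le> y k * f $ 2" using f x_y_bounds[of k] by simp_all
  moreover have "0 < f $ 1 \<Longrightarrow> 0 < x k * f $ 1" "0 < f $ 2 \<Longrightarrow> 0 < y k * f $ 2"
    using x_y_bounds[of k] by simp_all
  ultimately show ?thesis
    using f unfolding pairing_def by linarith
qed

section \<open>Column sums and infinitely many good indices\<close>

definition S :: "nat \<Rightarrow> int^3" where "S k = transpose (Psi p k) *v (\<chi> i. 1)"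

lemma S_Suc: "S (Suc k) = ns_induction p k *v S k"
  by (simp add: S_def transpose_Psi_Suc del: Psi.simps)

lemma entries:
  "0 \<le> A_inv_digit p (Suc k) $ 1 $ i" "0 \<le> A_inv_digit p (Suc k) $ 2 $ i"
  "0 < A_inv_digit p (Suc k) $ 3 $ i"
  "A_inv_digit p (Suc k) $ 1 $ i + A_inv_digit p (Suc k) $ 2 $ i \<le> 2 * A_inv_digit p (Suc k) $ 3 $ i"
  using A_inv_entries[OF n_ge m_ge] by (simp_all add: A_inv_digit_eq)

lemma S_pos: "0 < S k $ i"
proof (induction k arbitrary: i)
  case 0
  show ?case by (simp add: S_def transpose_mat)
next
  case (Suc k)
  show ?case
    unfolding S_Suc ns_induction_def transpose_mult_vector_nth
    using entries[of k i] Suc[of 1] Suc[of 2] Suc[of 3]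
    by (auto intro!: add_nonneg_pos add_nonneg_nonneg)
qed

definition good :: "nat \<Rightarrow> bool" where
  "good k \<longleftrightarrow> S k $ 1 \<le> 2 * S k $ 3 \<and> S k $ 2 \<le> 2 * S k $ 3"

text \<open>The new third entry is at least the sum of all old entries, while each of the other two
  is a sum of only two of them.\<close>

lemma good_Suc_upper:
  assumes "x k + y k > 1"
  shows "good (Suc k)"
proof -
  have "1 * S k $ 1 \<le> m k * S k $ 1" "1 * S k $ 2 \<le> n k * S k $ 2"
    "1 * S k $ 3 \<le> (n k + m k - 1) * S k $ 3"
    using n_ge[of k] m_ge[of k] S_pos[of k] by (intro mult_right_mono; simp add: less_imp_le)+
  moreover have "S (Suc k) $ 1 = S k $ 2 + S k $ 3" "S (Suc k) $ 2 = S k $ 1 + S k $ 3"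
    "S (Suc k) $ 3 = m k * S k $ 1 + n k * S k $ 2 + (n k + m k - 1) * S k $ 3"
    using assms unfolding S_Suc ns_induction_nth by simp_all
  ultimately show ?thesis
    using S_pos[of k 1] S_pos[of k 2] S_pos[of k 3] unfolding good_def by linarith
qed

text \<open>The third entry is regrouped by the new first two, so that a digit of at least 2 visibly
  makes it dominate the corresponding entry.\<close>

lemma S_Suc_lower:
  assumes "x k + y k < 1"
  shows "S (Suc k) $ 1 = S k $ 1 + S k $ 3" "S (Suc k) $ 2 = S k $ 2 + S k $ 3"
    "S (Suc k) $ 3 = (n k - 1) * S (Suc k) $ 1 + (m k - 1) * S (Suc k) $ 2 + S k $ 3"
  using assms unfolding S_Suc ns_induction_nth by (simp_all add: algebra_simps)

lemma S_Suc_dominates: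
  assumes "x k + y k < 1"
  shows "2 \<le> n k \<Longrightarrow> S (Suc k) $ 1 \<le> S (Suc k) $ 3" "2 \<le> m k \<Longrightarrow> S (Suc k) $ 2 \<le> S (Suc k) $ 3"
proof -
  have nonneg: "0 \<le> (n k - 1) * S (Suc k) $ 1" "0 \<le> (m k - 1) * S (Suc k) $ 2"
    using n_ge[of k] m_ge[of k] S_pos[of "Suc k"] by (intro mult_nonneg_nonneg; simp add: less_imp_le)+
  show "S (Suc k) $ 1 \<le> S (Suc k) $ 3" if "2 \<le> n k"
  proof -
    have "1 * S (Suc k) $ 1 \<le> (n k - 1) * S (Suc k) $ 1"
      using that S_pos[of "Suc k" 1] by (intro mult_right_mono) auto
    then show ?thesis using nonneg S_Suc_lower(3)[OF assms] S_pos[of k 3] by linarith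
  qed
  show "S (Suc k) $ 2 \<le> S (Suc k) $ 3" if "2 \<le> m k"
  proof -
    have "1 * S (Suc k) $ 2 \<le> (m k - 1) * S (Suc k) $ 2"
      using that S_pos[of "Suc k" 2] by (intro mult_right_mono) auto
    then show ?thesis using nonneg S_Suc_lower(3)[OF assms] S_pos[of k 3] by linarith
  qed
qed

lemma c_Suc_lower:
  assumes "x k + y k < 1"
  shows "c (Suc k) = c k * (1 - x k - y k)"
  using assms by (simp add: c_def)

text \<open>Each step lowers the positive weight \<open>c\<close> by
  \<open>c k * (x k + y k)\<close>, hence by at least \<open>a\<close>.\<close>

lemma no_infinite_descent:
  assumes lt: "\<And>k. N \<le> k \<Longrightarrow> x k + y k < 1"
    and a: "0 < a" "\<And>k. N \<le> k \<Longrightarrow> a \<le> c k * (x k + y k)"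
  shows False
proof -
  have "c (N + j) \<le> c N - j * a" for j
  proof (induction j)
    case (Suc j)
    have "c (N + Suc j) = c (N + j) - c (N + j) * (x (N + j) + y (N + j))"
      using c_Suc_lower[of "N + j"] lt by (simp add: algebra_simps)
    then show ?case
      using Suc a(2)[of "N + j"] by (simp add: algebra_simps)
  qed simp
  moreover obtain j :: nat where "c N < j * a" using reals_Archimedean3[OF a(1)] by blast
  ultimately show False using c_pos[of "N + j"] by (smt (verit))
qed

text \<open>A digit that stays \<open>1\<close> keeps the corresponding coordinate of \<open>c k (x k, y k, 1)\<close> constant.\<close>

lemma n_ge_2_frequently:
  assumes lt: "\<And>k. N \<le> k \<Longrightarrow> x k + y k < 1"
  shows "\<exists>k\<ge>N. 2 \<le> n k"
proof (rule ccontr)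
  assume "\<not> ?thesis"
  then have n1: "n k = 1" if "N \<le> k" for k
    using n_ge[of k] that by force
  have const: "c k * x k = c N * x N" if "N \<le> k" for k
    using that
  proof (induction k rule: dec_induct)
    case (step k)
    have "x k = (1 - x k - y k) * x (Suc k)"
      using step_lower(1)[OF lt[OF step(1)]] n1[OF step(1)] by simp
    then have "c (Suc k) * x (Suc k) = c k * x k"
      using c_Suc_lower[OF lt[OF step(1)]] by (metis mult.assoc)
    then show ?case using step by simp
  qed simp
  have "c N * x N \<le> c k * (x k + y k)" if "N \<le> k" for k
    using const[OF that] c_pos[of k] x_y_bounds[of k] by (simp add: distrib_left)
  then show False
    using no_infinite_descent[OF lt, where a = "c N * x N"] c_pos[of N] x_y_bounds[of N] by simp
qed

lemma m_ge_2_frequently: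
  assumes lt: "\<And>k. N \<le> k \<Longrightarrow> x k + y k < 1"
  shows "\<exists>k\<ge>N. 2 \<le> m k"
proof (rule ccontr)
  assume "\<not> ?thesis"
  then have m1: "m k = 1" if "N \<le> k" for k
    using m_ge[of k] that by force
  have const: "c k * y k = c N * y N" if "N \<le> k" for k
    using that
  proof (induction k rule: dec_induct)
    case (step k)
    have "y k = (1 - x k - y k) * y (Suc k)"
      using step_lower(2)[OF lt[OF step(1)]] m1[OF step(1)] by simp
    then have "c (Suc k) * y (Suc k) = c k * y k"
      using c_Suc_lower[OF lt[OF step(1)]] by (metis mult.assoc)
    then show ?case using step by simp
  qed simp
  have "c N * y N \<le> c k * (x k + y k)" if "N \<le> k" for k
    using const[OF that] c_pos[of k] x_y_bounds[of k] by (simp add: distrib_left)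
  then show False
    using no_infinite_descent[OF lt, where a = "c N * y N"] c_pos[of N] x_y_bounds[of N] by simp
qed

lemma good_frequently: "\<exists>k\<ge>N. good k"
proof (rule ccontr)
  assume "\<not> ?thesis"
  then have not_good: "\<not> good k" if "N \<le> k" for k using that by blast
  have lt: "x k + y k < 1" if "N \<le> k" for k
    using not_good[of "Suc k"] good_Suc_upper[of k] orbit_not_stops(3)[of k] that by force
  obtain k1 where k1: "N \<le> k1" "2 \<le> n k1" using n_ge_2_frequently lt by blast
  \<comment> \<open>\<open>n k1 \<ge> 2\<close> gives the start,
    \<open>S (Suc k1) $ 1 \<le> S (Suc k1) $ 3\<close>; the inequality then persists as long as no
    good index occurs.\<close>
  have inv: "S k $ 1 \<le> S k $ 2 + S k $ 3" if "Suc k1 \<le> k" for k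
    using that
  proof (induction k rule: dec_induct)
    case base
    show ?case using S_Suc_dominates(1)[OF lt[OF k1(1)] k1(2)] S_pos[of "Suc k1" 2] by linarith
  next
    case (step k)
    have k: "N \<le> k" using step k1 by simp
    note rec = S_Suc_lower[OF lt[OF k]]
    \<comment> \<open>With \<open>m k \<ge> 2\<close> the second entry drops below the third, and
      the first is at most twice the second by the inductive inequality, so \<open>Suc k\<close>
      would be good.\<close>
    have "m k < 2"
    proof (rule ccontr)
      assume "\<not> m k < 2"
      then have "S (Suc k) $ 2 \<le> S (Suc k) $ 3" using S_Suc_dominates(2)[OF lt[OF k]] by simp
      moreover have "S (Suc k) $ 1 \<le> 2 * S (Suc k) $ 2"
        using step.IH rec S_pos[of k 2] by linarith
      ultimately have "good (Suc k)" using S_pos[of "Suc k" 2] unfolding good_def by linarith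
      then show False using not_good[of "Suc k"] k by simp
    qed
    then have "m k = 1" using m_ge[of k] by simp
    \<comment> \<open>For \<open>n k = m k = 1\<close> the third entry is unchanged and each of the
      other two grows by it, so both sides grow equally; for \<open>n k \<ge> 2\<close> the third
      entry alone dominates the first.\<close>
    then show ?case
      using S_Suc_dominates(1)[OF lt[OF k]] rec step.IH S_pos[of "Suc k" 2] n_ge[of k]
      by (cases "n k = 1") simp_all
  qed
  \<comment> \<open>The next \<open>m k \<ge> 2\<close> turns the persisting inequality into a good
    index.\<close>
  obtain k where k: "Suc k1 \<le> k" "2 \<le> m k"
    using m_ge_2_frequently[of "Suc k1"] lt k1 by (meson Suc_leD le_trans)
  have N: "N \<le> k" using k k1 by simp
  have "S (Suc k) $ 2 \<le> S (Suc k) $ 3" using S_Suc_dominates(2)[OF lt[OF N] k(2)] .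
  moreover have "S (Suc k) $ 1 \<le> 2 * S (Suc k) $ 2"
    using inv[OF k(1)] S_Suc_lower[OF lt[OF N]] S_pos[of k 2] by linarith
  ultimately have "good (Suc k)" using S_pos[of "Suc k" 2] unfolding good_def by linarith
  then show False using not_good[of "Suc k"] N by simp
qed

section \<open>Contraction of the interval of quotients\<close>

definition enclosed :: "int^3 \<Rightarrow> real \<Rightarrow> real \<Rightarrow> nat \<Rightarrow> bool" where
  "enclosed v lo hi k \<longleftrightarrow> (\<forall>i. lo * real_of_int (S k $ i) \<le> real_of_int ((transpose (Psi p k) *v v) $ i) \<and>
    real_of_int ((transpose (Psi p k) *v v) $ i) \<le> hi * real_of_int (S k $ i))"

text \<open>Both vectors are transformed with the same non-negative coefficients, so new quotients
  are weighted means of old ones. Stating the bounds as products lets them simply be added.\<close>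

lemma enclosed_Suc:
  assumes "enclosed v lo hi k"
  shows "enclosed v lo hi (Suc k)"
  unfolding enclosed_def
proof
  fix i
  let ?f = "transpose (Psi p k) *v v"
  let ?b = "\<lambda>j. real_of_int (A_inv_digit p (Suc k) $ j $ i)"
  have b: "0 \<le> ?b 1" "0 \<le> ?b 2" "0 \<le> ?b 3" using entries[of k i] by simp_all
  have "?b 1 * (lo * S k $ 1) + ?b 2 * (lo * S k $ 2) + ?b 3 * (lo * S k $ 3)
      \<le> ?b 1 * ?f $ 1 + ?b 2 * ?f $ 2 + ?b 3 * ?f $ 3"
    "?b 1 * ?f $ 1 + ?b 2 * ?f $ 2 + ?b 3 * ?f $ 3
      \<le> ?b 1 * (hi * S k $ 1) + ?b 2 * (hi * S k $ 2) + ?b 3 * (hi * S k $ 3)"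
    using b assms unfolding enclosed_def by (intro add_mono mult_left_mono; simp)+
  then show "lo * S (Suc k) $ i \<le> (transpose (Psi p (Suc k)) *v v) $ i \<and>
      (transpose (Psi p (Suc k)) *v v) $ i \<le> hi * S (Suc k) $ i"
    unfolding transpose_Psi_Suc S_Suc ns_induction_def transpose_mult_vector_nth
    by (simp add: algebra_simps)
qed

lemma enclosed_mono:
  assumes "enclosed v lo hi k" "k \<le> l"
  shows "enclosed v lo hi l"
  using assms(2) by (induction l rule: dec_induct) (auto intro: assms(1) enclosed_Suc)

lemma enclosed_contraction:
  assumes "enclosed v lo hi k" "good k"
  shows "\<exists>lo' hi'. enclosed v lo' hi' (Suc k) \<and> hi' - lo' = 4 / 5 * (hi - lo)"
proof -
  let ?f = "transpose (Psi p k) *v v"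
  define r where "r = real_of_int (?f $ 3) / S k $ 3"
  have S3: "0 < real_of_int (S k $ 3)" using S_pos by simp
  have f3: "real_of_int (?f $ 3) = r * S k $ 3" using S3 by (simp add: r_def)
  have r: "lo \<le> r" "r \<le> hi"
    using assms(1) S3 unfolding enclosed_def r_def by (auto simp: field_simps)
  have S12: "real_of_int (S k $ 1) \<le> 2 * real_of_int (S k $ 3)"
    "real_of_int (S k $ 2) \<le> 2 * real_of_int (S k $ 3)"
    using assms(2) unfolding good_def by linarith+
  \<comment> \<open>Each end moves a fifth of its way towards \<open>r\<close>, the quotient of the
    third entries; together the moves amount to a fifth of the length wherever \<open>r\<close>
    lies.\<close>
  have "enclosed v (lo + (r - lo) / 5) (hi - (hi - r) / 5) (Suc k)"
    unfolding enclosed_def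
  proof
    fix i
    let ?b = "\<lambda>j. real_of_int (A_inv_digit p (Suc k) $ j $ i)"
    have b: "0 \<le> ?b 1" "0 \<le> ?b 2" "?b 1 + ?b 2 \<le> 2 * ?b 3" using entries[of k i] by linarith+
    have "(lo + (r - lo) / 5) * (?b 1 * S k $ 1 + ?b 2 * S k $ 2 + ?b 3 * S k $ 3)
        \<le> ?b 1 * ?f $ 1 + ?b 2 * ?f $ 2 + ?b 3 * ?f $ 3"
      using b S3 S12 assms(1) f3 r unfolding enclosed_def by (intro row_contraction) auto
    \<comment> \<open>The upper end is the lower end for the negated vector.\<close>
    moreover have "(- hi + (- r - - hi) / 5) * (?b 1 * S k $ 1 + ?b 2 * S k $ 2 + ?b 3 * S k $ 3)
        \<le> ?b 1 * (- ?f $ 1) + ?b 2 * (- ?f $ 2) + ?b 3 * (- ?f $ 3)"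
      using b S3 S12 assms(1) f3 r unfolding enclosed_def by (intro row_contraction) auto
    ultimately show "(lo + (r - lo) / 5) * S (Suc k) $ i \<le> (transpose (Psi p (Suc k)) *v v) $ i \<and>
        (transpose (Psi p (Suc k)) *v v) $ i \<le> (hi - (hi - r) / 5) * S (Suc k) $ i"
      unfolding transpose_Psi_Suc S_Suc ns_induction_def transpose_mult_vector_nth
      by (simp add: algebra_simps add_divide_distrib diff_divide_distrib)
  qed
  moreover have "(hi - (hi - r) / 5) - (lo + (r - lo) / 5) = 4 / 5 * (hi - lo)"
    by (simp add: field_simps)
  ultimately show ?thesis by blast
qed

lemma enclosed_narrow: "\<exists>C. \<forall>j. \<exists>k lo hi. enclosed v lo hi k \<and> hi - lo = (4 / 5) ^ j * C"
proof -
  \<comment> \<open>As \<open>S 0\<close> consists of ones, the quotients at index 0 are the entries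
    of \<open>v\<close> themselves.\<close>
  define M where "M = Max (range (\<lambda>i. \<bar>v $ i\<bar>))"
  have "\<bar>v $ i\<bar> \<le> M" for i unfolding M_def by (rule Max_ge) auto
  then have "- M \<le> v $ i \<and> v $ i \<le> M" for i by (metis abs_le_iff minus_le_iff)
  then have "- real_of_int M \<le> v $ i \<and> v $ i \<le> real_of_int M" for i
    by (metis of_int_le_iff of_int_minus)
  then have "enclosed v (- real_of_int M) M 0"
    by (simp add: enclosed_def S_def transpose_mat)
  then have "\<exists>k lo hi. enclosed v lo hi k \<and> hi - lo = (4 / 5) ^ j * (2 * M)" for j
  proof (induction j)
    case 0
    then show ?case by (intro exI conjI) auto
  next
    case (Suc j)
    then obtain k lo hi where *: "enclosed v lo hi k" "hi - lo = (4 / 5) ^ j * (2 * M)" by blast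
    \<comment> \<open>Waiting for the next good index costs nothing, since enclosures
      persist.\<close>
    obtain l where "l \<ge> k" "good l" using good_frequently by blast
    with enclosed_contraction enclosed_mono[OF *(1)] *(2) show ?case
      by (metis mult.assoc power_Suc)
  qed
  then show ?thesis by blast
qed

text \<open>The positive weights \<open>x k\<close>, \<open>y k\<close>, 1 turn the entrywise bounds
  into one bound, and \<open>pairing_eq\<close> carries it back to index 0 with the same factor
  \<open>c k\<close> on both sides. The resulting lower bound for \<open>hi\<close> does not depend
  on \<open>k\<close>.\<close>

lemma enclosed_pairing:
  assumes "enclosed v lo hi k"
  shows "pairing 0 v \<le> hi * pairing 0 (\<chi> i. 1)"
proof -
  let ?f = "transpose (Psi p k) *v v"
  have "pairing k ?f \<le> x k * (hi * S k $ 1) + y k * (hi * S k $ 2) + hi * S k $ 3"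
    using assms x_y_bounds[of k] unfolding pairing_def enclosed_def
    by (intro add_mono mult_left_mono) auto
  also have "\<dots> = hi * pairing k (S k)" by (simp add: pairing_def algebra_simps)
  finally show ?thesis
    using c_pos[of k] mult_left_mono[of "pairing k ?f" "hi * pairing k (S k)" "c k"]
    by (simp add: pairing_eq[of _ k] S_def algebra_simps)
qed

lemma eventually_nonneg:
  assumes "0 < pairing 0 v"
  shows "\<exists>k. transpose (Psi p k) *v v \<in> nonneg_int_vec"
proof -
  define \<sigma> where "\<sigma> = pairing 0 (\<chi> i. 1)"
  have \<sigma>: "0 < \<sigma>"
    unfolding \<sigma>_def by (rule pairing_pos) (auto simp: nonneg_int_vec_def vec_eq_iff)
  obtain C where C: "\<And>j. \<exists>k lo hi. enclosed v lo hi k \<and> hi - lo = (4 / 5) ^ j * C"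
    using enclosed_narrow by blast
  have "(\<lambda>j. (4 / 5) ^ j * C) \<longlonglongrightarrow> 0 * C"
    by (intro tendsto_mult tendsto_const LIMSEQ_power_zero) simp
  moreover have "0 * C < pairing 0 v / \<sigma>" using assms \<sigma> by simp
  ultimately have "\<forall>\<^sub>F j in sequentially. (4 / 5) ^ j * C < pairing 0 v / \<sigma>"
    by (rule order_tendstoD(2))
  then obtain j where "(4 / 5) ^ j * C < pairing 0 v / \<sigma>"
    by (auto simp: eventually_sequentially)
  with C obtain k lo hi where k: "enclosed v lo hi k" and w: "hi - lo < pairing 0 v / \<sigma>" by metis
  \<comment> \<open>The interval is shorter than this lower bound for its upper end, so its lower
    end is positive.\<close>
  have "pairing 0 v / \<sigma> \<le> hi"
    using enclosed_pairing[OF k] \<sigma> by (simp add: \<sigma>_def divide_le_eq)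
  then have lo: "0 < lo" using w by linarith
  have "0 \<le> (transpose (Psi p k) *v v) $ i" for i
  proof -
    have "0 < lo * S k $ i" using lo S_pos[of k i] by simp
    also have "\<dots> \<le> (transpose (Psi p k) *v v) $ i" using k unfolding enclosed_def by simp
    finally show ?thesis by simp
  qed
  then show ?thesis by (auto simp: nonneg_int_vec_def)
qed

section \<open>The cone as a union, and the dimension group\<close>

lemma P_cone_eq: "P_cone p = {0} \<union> {v. 0 < pairing 0 v}"
  by (auto simp: P_cone_def pairing_def inner_vec_def sum_3 x_def y_def)

text \<open>A positive pairing makes some transported vector non-negative; conversely a nonzero
  non-negative vector pairs positively at every index, and \<open>c k\<close> keeps the
  sign.\<close>

lemma P_cone_eq_Union: "P_cone p = (\<Union>k. theta p k ` nonneg_int_vec)"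
proof (rule subset_antisym; rule subsetI)
  fix v assume "v \<in> P_cone p"
  then have "\<exists>k. transpose (Psi p k) *v v \<in> nonneg_int_vec"
    using eventually_nonneg by (auto simp: P_cone_eq nonneg_int_vec_def)
  then obtain k where "transpose (Psi p k) *v v \<in> nonneg_int_vec" ..
  then show "v \<in> (\<Union>k. theta p k ` nonneg_int_vec)"
    by (intro UN_I[of k] image_eqI[of v _ "transpose (Psi p k) *v v"]) auto
next
  fix v assume "v \<in> (\<Union>k. theta p k ` nonneg_int_vec)"
  then obtain k w where w: "w \<in> nonneg_int_vec" "v = theta p k w" by blast
  show "v \<in> P_cone p"
  proof (cases "w = 0")
    case True
    then show ?thesis using w by (simp add: P_cone_eq theta_eq)
  next
    case False
    have "pairing 0 v = c k * pairing k w" using w pairing_eq[of v k] by simp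
    then show ?thesis using c_pos pairing_pos[OF w(1) False] by (simp add: P_cone_eq)
  qed
qed

end

lemma comm_group_int_vec_group: "comm_group (int_vec_group :: (int^'n) monoid)"
proof -
  have "\<exists>w. w + v = 0" for v :: "int^'n" by (metis left_minus)
  then have "group (int_vec_group :: (int^'n) monoid)"
    by (intro groupI) (simp_all add: int_vec_group_def add.assoc)
  then show ?thesis
    by (rule group.group_comm_groupI) (simp add: int_vec_group_def add.commute)
qed

lemma inv_int_vec_group: "inv\<^bsub>int_vec_group\<^esub> v = - v" for v :: "int^'n"
proof -
  interpret comm_group "int_vec_group :: (int^'n) monoid" by (rule comm_group_int_vec_group)
  show ?thesis by (rule inv_equality) (simp_all add: int_vec_group_def)
qed

lemma pow_int_vec_group: "v [^]\<^bsub>int_vec_group\<^esub> (k::nat) = of_nat k *s v" for v :: "int^'n"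
  by (induction k) (simp_all add: nat_pow_def int_vec_group_def vec_eq_iff algebra_simps)

lemma hom_int_vec_groupI:
  assumes "\<And>v w. f (v + w) = f v + f w"
  shows "f \<in> hom int_vec_group int_vec_group"
  using assms by (simp add: hom_def int_vec_group_def)

context ns_orbit
begin

text \<open>Zero together with an open half-space of a linear form: all axioms reduce to the sign of
  that form.\<close>

lemma positive_cone_P_cone: "positive_cone int_vec_group (P_cone p)"
proof -
  have add: "pairing 0 (v + w) = pairing 0 v + pairing 0 w"
    and minus: "pairing 0 (- v) = - pairing 0 v"
    and scale: "pairing 0 (of_nat k *s v) = real k * pairing 0 v" for v w k
    by (simp_all add: pairing_def algebra_simps)
  have set_mult: "A <#>\<^bsub>int_vec_group\<^esub> B = {a + b | a b. a \<in> A \<and> b \<in> B}" for A B :: "(int^3) set"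
    by (auto simp: set_mult_def int_vec_group_def)
  have set_inv: "set_inv\<^bsub>int_vec_group\<^esub> A = uminus ` A" for A :: "(int^3) set"
    by (auto simp: SET_INV_def inv_int_vec_group)
  have "\<exists>a \<in> P_cone p. \<exists>b \<in> P_cone p. v = a - b" for v
  proof -
    \<comment> \<open>The third weight is 1, so \<open>N\<close> times the third unit vector pairs
      to \<open>N\<close>; the added 1 makes \<open>N\<close> positive and larger than the negative
      of the pairing of \<open>v\<close>.\<close>
    define N where "N = \<bar>\<lceil>pairing 0 v\<rceil>\<bar> + 1"
    let ?b = "\<chi> i. if i = 3 then N else 0"
    have b: "pairing 0 ?b = N" by (simp add: pairing_def)
    moreover have "0 < real_of_int N" "0 < pairing 0 v + N" unfolding N_def by linarith+
    ultimately have "?b \<in> P_cone p" "v + ?b \<in> P_cone p" by (simp_all add: P_cone_eq add)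
    then show ?thesis by (metis add_diff_cancel)
  qed
  then have "P_cone p <#>\<^bsub>int_vec_group\<^esub> set_inv\<^bsub>int_vec_group\<^esub> (P_cone p) = UNIV"
    unfolding set_mult set_inv by (auto simp: set_eq_iff) (metis diff_conv_add_uminus imageI)
  moreover have "P_cone p <#>\<^bsub>int_vec_group\<^esub> P_cone p \<subseteq> P_cone p"
    unfolding set_mult by (auto simp: P_cone_eq add)
  moreover have "P_cone p \<inter> set_inv\<^bsub>int_vec_group\<^esub> (P_cone p) = {0}"
    unfolding set_inv by (auto simp: P_cone_eq minus)
  moreover have "v \<in> P_cone p" if "0 < k" "of_nat k *s v \<in> P_cone p" for v and k :: nat
  proof (cases "of_nat k *s v = 0")
    case True
    then have "v = 0" using that(1) by (simp add: vec_eq_iff)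
    then show ?thesis by (simp add: P_cone_eq)
  next
    case False
    then show ?thesis using that by (auto simp: P_cone_eq scale zero_less_mult_iff)
  qed
  moreover have "carrier int_vec_group = (UNIV :: (int^3) set)" "\<one>\<^bsub>int_vec_group\<^esub> = (0 :: int^3)"
    by (simp_all add: int_vec_group_def)
  ultimately show ?thesis
    by (auto simp: positive_cone_def pow_int_vec_group)
qed

lemma is_dimension_group_P_cone:
  "is_dimension_group int_vec_group (P_cone p) (theta p) (ns_induction p)"
proof -
  have "positive_induction (ns_induction p)"
    unfolding positive_induction_def
  proof (intro allI)
    fix k i j
    show "0 \<le> ns_induction p k $ i $ j"
      using entries[of k i] exhaust_3[of j] by (auto simp: ns_induction_def transpose_def)
  qed
  moreover obtain \<phi> where \<phi>: "\<phi> \<in> iso (matrix_limit (ns_induction p)) int_vec_group"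
    "\<And>k v. \<phi> (matrix_limit_hom (ns_induction p) k v) = theta p k v"
  proof -
    let ?G = "\<lambda>_::nat. int_vec_group :: (int^3) monoid"
    have inj: "inj_on (theta p k) A" for k A
      by (rule inj_onI) (metis theta_right_inverse)
    \<comment> \<open>Index 0 suffices, where \<open>theta\<close> is the identity.\<close>
    have surj: "w \<in> (\<Union>k. theta p k ` carrier int_vec_group)" for w
      by (rule UN_I[of 0]) (simp_all add: theta_def int_vec_group_def)
    show thesis
    proof (rule inductive_limit_iso[of ?G int_vec_group "\<lambda>k v. ns_induction p k *v v" "theta p"])
      show "(\<lambda>v. ns_induction p k *v v) \<in> hom int_vec_group int_vec_group"
        "theta p k \<in> hom int_vec_group int_vec_group" for k
        by (auto intro!: hom_int_vec_groupI simp: theta_eq matrix_vector_right_distrib)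
      fix \<phi>
      assume "\<phi> \<in> iso (inductive_limit ?G (\<lambda>k v. ns_induction p k *v v)) int_vec_group"
        and "\<And>k g. g \<in> carrier int_vec_group \<Longrightarrow>
          \<phi> (canonical_hom ?G (\<lambda>k v. ns_induction p k *v v) k g) = theta p k g"
      then show thesis
        by (intro that) (simp_all add: matrix_limit_def matrix_limit_hom_def int_vec_group_def)
    qed (use inj surj theta_ns_induction comm_group_int_vec_group in blast)+
  qed
  \<comment> \<open>Both cones are unions over \<open>k\<close> of images of the non-negative
    vectors, and \<open>\<phi>\<close> matches them stage by stage.\<close>
  moreover have "\<phi> ` matrix_limit_cone (ns_induction p) = P_cone p"
    using \<phi>(2) unfolding P_cone_eq_Union matrix_limit_cone_def natural_cone_def matrix_limit_hom_def
    by (simp add: image_UN image_image)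
  ultimately show ?thesis
    unfolding is_dimension_group_def using positive_cone_P_cone by blast
qed

end

theorem theorem4p1:
  fixes \<alpha> \<beta> :: real
  assumes "(\<alpha>, \<beta>) \<in> ns_domain"
    and "\<not> ns_stops (\<alpha>, \<beta>)"
  shows "is_dimension_group int_vec_group (P_cone (\<alpha>, \<beta>)) (theta (\<alpha>, \<beta>)) (ns_induction (\<alpha>, \<beta>)) \<and>
         P_cone (\<alpha>, \<beta>) = (\<Union>k. theta (\<alpha>, \<beta>) k ` nonneg_int_vec)"
proof -
  interpret ns_orbit "(\<alpha>, \<beta>)" using assms by (rule ns_orbit.intro)
  show ?thesis using is_dimension_group_P_cone P_cone_eq_Union by blast
qed

end
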